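(* Let $X$ be a Tychonoff space and let $Q \subseteq X$ be a countable set. Then there is a continuous function $f : X^\omega \to \mathbb{R}^2$ such that the restriction of $f$ to $Q^\omega$ is injective.
   Context: "Countable" means of cardinality at most $\aleph_0$ (finite sets included). $X^\omega$ is the product of countably infinitely many copies of $X$, with the product topology, and $Q^\omega \subseteq X^\omega$ is the set of all sequences with all terms in $Q$. *)

theory Defs
  imports "HOL-Analysis.Analysis"
begin

definition tychonoff_space :: "'a topology \<Rightarrow> bool" where
  "tychonoff_space X \<longleftrightarrow> completely_regular_space X \<and> t1_space X"

definition omega_power :: "'a topology \<Rightarrow> (nat \<Rightarrow> 'a) topology" where
  "omega_power X = product_topology (\<lambda>_. X) UNIV"

end

theory Submission
  imports Defs
begin

text \<open>
  Countably many real functions separate the points of Q, so X may be replaced by a metric space.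
  On the power, choose continuous \<open>u\<^sub>0, u\<^sub>1, \<dots>\<close> with values in [0,1] that are positive, take countably many
  values and are locally constant on \<open>Q\<^sup>\<omega>\<close>, and such that \<open>u\<^sub>k\<close> vanishes wherever one of its predecessors
  is not locally constant. Then a term \<open>a(u\<^sub>0, \<dots>, u\<^sub>k\<^sub>-\<^sub>1) u\<^sub>k\<close> is continuous for an arbitrary bounded
  function a, and the plane map has the sum of the even terms and the sum of the odd terms as its
  coordinates. It runs into a dendrite-like set: a trunk with hairs attached at countably many points,
  alternately horizontal and vertical, each hair again carrying hairs, and so on. The position
  \<open>u\<^sub>k\<close> of a hair can be read off because only finitely many competing hairs are long enough to reach
  a given height, and the weight a of the next perpendicular level is chosen smaller than the distance to
  each of them.
\<close>

section \<open>Functions locally constant at countably many points\<close>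

text \<open>Composing with \<open>\<theta>\<close> changes a nonnegative function by a factor of at
  most 2 and flattens it around prescribed positive values. Deleting small intervals around
  \<open>D\<close> from \<open>{0..t}\<close> costs at most half of the length. The lower bound
  \<open>t / 2\<close> rules out flatness at 0.\<close>

lemma collapsing_function:
  fixes D :: "real set"
  assumes D: "countable D" "D \<subseteq> {0<..}"
  obtains \<theta> :: "real \<Rightarrow> real" where "continuous_on UNIV \<theta>"
    "\<And>t. 0 \<le> t \<Longrightarrow> t / 2 \<le> \<theta> t \<and> \<theta> t \<le> t"
    "\<And>d. d \<in> D \<Longrightarrow> \<forall>\<^sub>F s in nhds d. \<theta> s = \<theta> d"
proof (cases "D = {}")
  case True
  show ?thesis
    by (rule that[of "\<lambda>t. t"]) (use True in auto)
next
  case False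
  define e where "e = from_nat_into D"
  have e: "range e = D" unfolding e_def using D False by (simp add: range_from_nat_into)
  have epos: "e n > 0" for n using e D by auto
  \<comment> \<open>The radius is proportional to \<open>e n\<close>, so that only intervals with
    \<open>e n \<le> 2 * t\<close> meet \<open>{0..t}\<close>. Such an interval has length
    \<open>e n * (1/2)^n / 8\<close>, at most \<open>t / 4 * (1/2)^n\<close>, and these bounds add
    up to \<open>t / 2\<close>.\<close>
  define I where "I n = ball (e n) (e n * (1/2)^n / 16)" for n
  define U where "U = (\<Union>n. I n)"
  have U: "open U" by (auto simp: U_def I_def)
  then have Ub: "U \<in> sets lborel" by simp
  \<comment> \<open>A devil's staircase that is flat on the small neighbourhood U of D.\<close>
  define \<theta> where "\<theta> t = measure lborel ({0..t} - U)" for t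
  have Icc: "{s..t::real} \<in> fmeasurable lborel" for s t
    by (rule fmeasurableI) (simp_all add: emeasure_lborel_Icc_eq)
  have fin: "{0..t} - U \<in> fmeasurable lborel" for t
    by (rule fmeasurableI2[of "{0..t}"]) (use Ub Icc in auto)
  have lip1: "\<theta> s \<le> \<theta> t \<and> \<theta> t \<le> \<theta> s + (t - s)" if "s \<le> t" for s t
  proof
    show "\<theta> s \<le> \<theta> t" unfolding \<theta>_def
      by (rule measure_mono_fmeasurable) (use that fin fmeasurableD[OF fin] in auto)
    have "\<theta> t \<le> measure lborel (({0..s} - U) \<union> {s..t})" unfolding \<theta>_def
      by (rule measure_mono_fmeasurable) (use that fin fmeasurableD[OF fin] Icc in \<open>auto intro!: fmeasurable.Un\<close>)
    also have "\<dots> \<le> \<theta> s + measure lborel {s..t}" unfolding \<theta>_def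
      by (rule measure_Un_le) (use Ub in auto)
    finally show "\<theta> t \<le> \<theta> s + (t - s)" using that by simp
  qed
  have lip: "\<bar>\<theta> s - \<theta> t\<bar> \<le> 1 * \<bar>s - t\<bar>" for s t
    using lip1[of s t] lip1[of t s] by (cases "s \<le> t") auto
  have "1-lipschitz_on UNIV \<theta>"
    by (rule lipschitz_onI) (use lip in \<open>auto simp: dist_real_def\<close>)
  then have c: "continuous_on UNIV \<theta>" by (rule lipschitz_on_continuous_on)
  have half: "t / 2 \<le> \<theta> t \<and> \<theta> t \<le> t" if "0 \<le> t" for t
  proof
    have "\<theta> 0 = 0"
    proof -
      have "\<theta> 0 \<le> measure lborel {0..0::real}" unfolding \<theta>_def
        by (rule measure_mono_fmeasurable) (use fmeasurableD[OF fin[of 0]] Icc[of 0 0] in auto)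
      then show ?thesis by (simp add: \<theta>_def measure_le_0_iff)
    qed
    then show "\<theta> t \<le> t" using lip1[of 0 t] that by simp
    have small: "emeasure lborel (I n \<inter> {0..t}) \<le> ennreal (t / 4 * (1/2)^n)" for n
    proof (cases "I n \<inter> {0..t} = {}")
      case True
      then show ?thesis by simp
    next
      case False
      then obtain x where x: "\<bar>e n - x\<bar> < e n * (1/2)^n / 16" "x \<le> t"
        by (auto simp: I_def dist_real_def)
      have p1: "(1/2::real)^n \<le> 1" by (simp add: power_le_one)
      have "e n * (1/2)^n \<le> e n" using mult_left_mono[OF p1, of "e n"] epos[of n] by simp
      then have "e n \<le> 2 * t" using x epos[of n] by linarith
      then have le: "e n * (1/2)^n \<le> 2 * t * (1/2)^n" by (intro mult_right_mono) auto
      have "emeasure lborel (I n \<inter> {0..t}) \<le> emeasure lborel {e n - e n * (1/2)^n / 16 .. e n + e n * (1/2)^n / 16}"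
        by (intro emeasure_mono) (auto simp: I_def dist_real_def abs_if split: if_splits)
      also have "\<dots> = ennreal (2 * (e n * (1/2)^n / 16))"
        by (subst emeasure_lborel_Icc) (use epos[of n] in auto)
      also have "\<dots> \<le> ennreal (t / 4 * (1/2)^n)"
        by (intro ennreal_leI) (use le in simp)
      finally show ?thesis .
    qed
    have "emeasure lborel (\<Union>n. I n \<inter> {0..t}) \<le> (\<Sum>n. emeasure lborel (I n \<inter> {0..t}))"
      by (rule emeasure_subadditive_countably) (auto simp: I_def)
    also have "\<dots> \<le> (\<Sum>n. ennreal (t / 4 * (1/2)^n))"
      by (intro suminf_le small) auto
    also have "\<dots> = ennreal (\<Sum>n. t / 4 * (1/2)^n)"
      by (intro suminf_ennreal2) (use that in \<open>auto intro!: summable_mult summable_geometric\<close>)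
    also have "(\<Sum>n. t / 4 * (1/2)^n) = t / 2"
      by (subst suminf_mult) (auto simp: suminf_geometric intro!: summable_geometric)
    also have "(\<Union>n. I n \<inter> {0..t}) = U \<inter> {0..t}" by (auto simp: U_def)
    finally have "emeasure lborel (U \<inter> {0..t}) \<le> ennreal (t / 2)" .
    then have "measure lborel (U \<inter> {0..t}) \<le> t / 2"
      unfolding measure_def using that by (intro enn2real_leI) auto
    moreover have "t \<le> \<theta> t + measure lborel (U \<inter> {0..t})"
    proof -
      have "measure lborel {0..t} \<le> measure lborel (({0..t} - U) \<union> (U \<inter> {0..t}))"
        by (rule eq_refl, rule arg_cong[of _ _ "measure lborel"]) auto
      also have "\<dots> \<le> \<theta> t + measure lborel (U \<inter> {0..t})" unfolding \<theta>_def
        by (rule measure_Un_le) (use Ub in auto)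
      finally show ?thesis using that by simp
    qed
    ultimately show "t / 2 \<le> \<theta> t" by simp
  qed
  have "\<forall>\<^sub>F s in nhds d. \<theta> s = \<theta> d" if "d \<in> D" for d
  proof -
    obtain n where n: "d = e n" using \<open>d \<in> D\<close> unfolding e[symmetric] by auto
    have "d \<in> I n" using epos[of n] by (simp add: I_def n)
    moreover have "\<theta> s = \<theta> d" if s: "s \<in> I n" for s
    proof -
      have "x \<in> I n" if "min s d \<le> x" "x \<le> max s d" for x
        using s \<open>d \<in> I n\<close> that unfolding I_def mem_ball dist_real_def by linarith
      then have sub: "x \<in> U" if "min s d \<le> x" "x \<le> max s d" for x
        using that by (auto simp: U_def)
      \<comment> \<open>The whole segment between \<open>s\<close> and \<open>d\<close> lies in
        \<open>U\<close>, so moving the right end from \<open>d\<close> to \<open>s\<close> changes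
        nothing outside \<open>U\<close>.\<close>
      have "x \<le> s \<longleftrightarrow> x \<le> d" if "x \<notin> U" for x
        using sub[of x] that by linarith
      then have "{0..s} - U = {0..d} - U" by auto
      then show ?thesis by (simp add: \<theta>_def)
    qed
    moreover have "open (I n)" by (simp add: I_def)
    ultimately show ?thesis unfolding eventually_nhds by blast
  qed
  then show ?thesis using that c half by blast
qed

lemma locally_constant_compose:
  assumes "continuous_on UNIV r" "\<forall>\<^sub>F y in nhds (r x). f y = f (r x)"
  shows "\<forall>\<^sub>F y in nhds x. f (r y) = f (r x)"
proof -
  have "filterlim r (nhds (r x)) (nhds x)"
    using assms(1) by (auto simp: continuous_on_def tendsto_at_iff_tendsto_nhds)
  then show ?thesis using assms(2) unfolding filterlim_iff by blast
qed

text \<open>A collapsing function is taken for the countable set of values of \<open>w\<close> on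
  \<open>C\<close>; near a point of \<open>C\<close>, continuity keeps \<open>w\<close> inside the
  flat piece around its value there.\<close>

lemma collapse_near_countable:
  fixes w :: "'a::topological_space \<Rightarrow> real"
  assumes w: "continuous_on UNIV w" "\<And>x. 0 \<le> w x" and C: "countable C" "\<And>x. x \<in> C \<Longrightarrow> 0 < w x"
  obtains B where "continuous_on UNIV B" "\<And>x. w x / 2 \<le> B x \<and> B x \<le> w x"
    "\<And>x. x \<in> C \<Longrightarrow> \<forall>\<^sub>F y in nhds x. B y = B x"
proof -
  obtain \<theta> where \<theta>: "continuous_on UNIV \<theta>" "\<And>t. 0 \<le> t \<Longrightarrow> t / 2 \<le> \<theta> t \<and> \<theta> t \<le> t"
    "\<And>d. d \<in> w ` C \<Longrightarrow> \<forall>\<^sub>F s in nhds d. \<theta> s = \<theta> d"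
    by (rule collapsing_function[of "w ` C"]) (use C in auto)
  show ?thesis
  proof (rule that[of "\<lambda>x. \<theta> (w x)"])
    show "continuous_on UNIV (\<lambda>x. \<theta> (w x))"
      by (rule continuous_on_compose2[OF \<theta>(1) w(1)]) auto
    show "w x / 2 \<le> \<theta> (w x) \<and> \<theta> (w x) \<le> w x" for x using \<theta>(2) w(2) by blast
    fix x assume "x \<in> C"
    then show "\<forall>\<^sub>F y in nhds x. \<theta> (w y) = \<theta> (w x)"
      by (intro locally_constant_compose[OF w(1)] \<theta>(3) imageI)
  qed
qed

lemma open_locally_constant:
  fixes f :: "'a::topological_space \<Rightarrow> 'b"
  shows "open {x. \<forall>\<^sub>F y in nhds x. f y = f x}"
proof (subst open_subopen, safe)
  fix x assume "\<forall>\<^sub>F y in nhds x. f y = f x"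
  then obtain S where S: "open S" "x \<in> S" "\<And>y. y \<in> S \<Longrightarrow> f y = f x"
    unfolding eventually_nhds by blast
  have "\<forall>\<^sub>F y in nhds z. f y = f z" if "z \<in> S" for z
    unfolding eventually_nhds using S that by metis
  then have "S \<subseteq> {x. \<forall>\<^sub>F y in nhds x. f y = f x}" by blast
  with S show "\<exists>T. open T \<and> x \<in> T \<and> T \<subseteq> {x. \<forall>\<^sub>F y in nhds x. f y = f x}" by blast
qed

section \<open>Bumps whose values record another function\<close>

text \<open>For fixed \<open>g\<close>, \<open>g'\<close>, \<open>s\<close>, \<open>s'\<close> the
  equation is linear in \<open>l\<close>. If its coefficient \<open>g * s - g' * s'\<close>
  vanished, then \<open>g = g'\<close>, and \<open>s = s'\<close> because \<open>g > 0\<close>. So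
  each quadruple excludes at most one \<open>l\<close>.\<close>

lemma countable_affine_collisions:
  fixes G H :: "real set"
  assumes "countable G" "countable H" "G \<subseteq> {0<..}"
  shows "countable {l. \<exists>g\<in>G. \<exists>g'\<in>G. \<exists>s\<in>H. \<exists>s'\<in>H. s \<noteq> s' \<and> g * (1 + l * s) = g' * (1 + l * s')}"
proof -
  have "{l. \<exists>g\<in>G. \<exists>g'\<in>G. \<exists>s\<in>H. \<exists>s'\<in>H. s \<noteq> s' \<and> g * (1 + l * s) = g' * (1 + l * s')}
    \<subseteq> (\<lambda>(g, g', s, s'). (g' - g) / (g * s - g' * s')) ` (G \<times> G \<times> H \<times> H)"
  proof clarify
    fix l g g' s s' assume h: "g \<in> G" "g' \<in> G" "s \<in> H" "s' \<in> H" "s \<noteq> s'"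
      "g * (1 + l * s) = g' * (1 + l * s')"
    then have eq: "l * (g * s - g' * s') = g' - g" by (simp add: algebra_simps)
    have "g * s - g' * s' \<noteq> 0"
    proof
      assume z: "g * s - g' * s' = 0"
      with eq have "g = g'" by simp
      moreover have "g > 0" using h assms by auto
      ultimately show False using z h by simp
    qed
    then have "l = (g' - g) / (g * s - g' * s')" using eq by (simp add: field_simps)
    then show "l \<in> (\<lambda>(g, g', s, s'). (g' - g) / (g * s - g' * s')) ` (G \<times> G \<times> H \<times> H)"
      using h by force
  qed
  then show ?thesis by (rule countable_subset) (use assms in auto)
qed

text \<open>Builds a single \<open>u\<close> from its permitted support \<open>W\<close> and the
  information \<open>v\<close> it has to carry. Collapsing the distance to the complement of
  \<open>W\<close> gives a bump \<open>B\<close>; the factor \<open>1 + l * v\<close> with generic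
  \<open>l\<close> stores \<open>v\<close> and preserves support, positivity and local constancy on
  \<open>C\<close>.\<close>

lemma encoding_bump:
  fixes v :: "'a::metric_space \<Rightarrow> real"
  assumes W: "open W" "C \<subseteq> W" and C: "countable C"
    and v: "continuous_on UNIV v" "\<And>x. 0 \<le> v x \<and> v x \<le> 1" "\<forall>x\<in>C. \<forall>\<^sub>F y in nhds x. v y = v x"
  shows "\<exists>u :: 'a \<Rightarrow> real. continuous_on UNIV u \<and> (\<forall>x. 0 \<le> u x \<and> u x \<le> 1) \<and> (\<forall>x. x \<notin> W \<longrightarrow> u x = 0) \<and>
    (\<forall>x\<in>C. 0 < u x) \<and> (\<forall>x\<in>C. \<forall>\<^sub>F y in nhds x. u y = u x) \<and>
    (\<forall>x\<in>C. \<forall>y\<in>C. u x = u y \<longrightarrow> v x = v y)"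
proof -
  \<comment> \<open>\<open>infdist\<close> to the empty set is 0 by convention, so
    \<open>W = UNIV\<close> is treated apart.\<close>
  define w where "w x = (if W = UNIV then 1 else min 1 (infdist x (- W)))" for x
  have wc: "continuous_on UNIV w"
    unfolding w_def by (cases "W = UNIV") (auto intro!: continuous_intros)
  have w01: "0 \<le> w x \<and> w x \<le> 1" for x by (auto simp: w_def infdist_nonneg)
  have w0: "w x = 0" if "x \<notin> W" for x using that by (auto simp: w_def)
  have wpos: "0 < w x" if "x \<in> W" for x
  proof (cases "W = UNIV")
    case False
    then have "infdist x (- W) \<noteq> 0"
      using that W in_closed_iff_infdist_zero[of "- W" x] by auto
    then show ?thesis using infdist_nonneg[of x "- W"] by (auto simp: w_def)
  qed (simp add: w_def)
  obtain B where B: "continuous_on UNIV B" "\<And>x. w x / 2 \<le> B x \<and> B x \<le> w x"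
    "\<And>x. x \<in> C \<Longrightarrow> \<forall>\<^sub>F y in nhds x. B y = B x"
    by (rule collapse_near_countable[OF wc _ C]) (use w01 wpos W in auto)
  have Bpos: "0 < B x" if "x \<in> C" for x using B(2)[of x] wpos[of x] that W by auto
  have B01: "0 \<le> B x \<and> B x \<le> 1" for x using B(2)[of x] w01[of x] by auto
  \<comment> \<open>The values l for which \<open>B (1 + l v)\<close> fails to determine v on the countable set C.\<close>
  define bad where "bad = {l. \<exists>g\<in>B ` C. \<exists>g'\<in>B ` C. \<exists>s\<in>v ` C. \<exists>s'\<in>v ` C. s \<noteq> s' \<and> g * (1 + l * s) = g' * (1 + l * s')}"
  have "countable bad" unfolding bad_def by (rule countable_affine_collisions) (use C Bpos in auto)
  moreover have "uncountable {0<..<1::real}" by (simp add: uncountable_open_interval)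
  ultimately have "\<not> {0<..<1} \<subseteq> bad" using countable_subset by blast
  then obtain l where l: "0 < l" "l < 1" "l \<notin> bad"
    by (auto simp: subset_iff)
  have lv: "0 \<le> l * v x \<and> l * v x \<le> 1" for x
    using v(2)[of x] l by (simp add: mult_le_one)
  show ?thesis
  proof (intro exI[of _ "\<lambda>x. B x * (1 + l * v x) / 2"] conjI allI impI ballI)
    show "continuous_on UNIV (\<lambda>x. B x * (1 + l * v x) / 2)"
      by (intro continuous_intros B(1) v(1)) auto
    show "0 \<le> B x * (1 + l * v x) / 2" for x using B01[of x] lv[of x] by simp
    show "B x * (1 + l * v x) / 2 \<le> 1" for x
    proof -
      have "B x * (1 + l * v x) \<le> 1 * 2" by (rule mult_mono) (use B01[of x] lv[of x] in auto)
      then show ?thesis by simp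
    qed
    show "B x * (1 + l * v x) / 2 = 0" if "x \<notin> W" for x
      using B(2)[of x] w0[OF that] by auto
    fix x assume x: "x \<in> C"
    show "0 < B x * (1 + l * v x) / 2" using Bpos[OF x] lv[of x] by simp
    show "\<forall>\<^sub>F y in nhds x. B y * (1 + l * v y) / 2 = B x * (1 + l * v x) / 2"
      using B(3)[OF x] bspec[OF v(3) x] by eventually_elim simp
    fix y assume y: "y \<in> C" and "B x * (1 + l * v x) / 2 = B y * (1 + l * v y) / 2"
    then have "B x * (1 + l * v x) = B y * (1 + l * v y)" by simp
    then have "v x \<noteq> v y \<Longrightarrow> l \<in> bad"
      unfolding bad_def mem_Collect_eq using x y by (intro bexI[of _ "B x"] bexI[of _ "B y"] bexI[of _ "v x"] bexI[of _ "v y"] conjI imageI)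
    then show "v x = v y" using l(3) by blast
  qed
qed

section \<open>Separating the points of a countable metric subset\<close>

lemma separating_locally_constant:
  fixes Q :: "'a::metric_space set"
  assumes Q: "countable Q"
  obtains \<phi> :: "nat \<Rightarrow> 'a \<Rightarrow> real" where "\<And>n. continuous_on UNIV (\<phi> n)" "\<And>n x. 0 \<le> \<phi> n x \<and> \<phi> n x \<le> 1"
    "\<And>n x. x \<in> Q \<Longrightarrow> \<forall>\<^sub>F y in nhds x. \<phi> n y = \<phi> n x"
    "\<And>x y. x \<in> Q \<Longrightarrow> y \<in> Q \<Longrightarrow> x \<noteq> y \<Longrightarrow> \<exists>n. \<phi> n x \<noteq> \<phi> n y"
proof -
  \<comment> \<open>Stated for all pairs, with separation guarded by \<open>a \<noteq> b\<close>, so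
    that the enumeration below yields admissible functions on the diagonal and for empty
    \<open>Q\<close>, where \<open>from_nat_into\<close> is arbitrary.\<close>
  define P :: "'a \<Rightarrow> 'a \<Rightarrow> ('a \<Rightarrow> real) \<Rightarrow> bool" where
    "P a b B \<longleftrightarrow> continuous_on UNIV B \<and> (\<forall>x. 0 \<le> B x \<and> B x \<le> 1) \<and>
      (\<forall>x\<in>Q. \<forall>\<^sub>F y in nhds x. B y = B x) \<and> (a \<noteq> b \<longrightarrow> B a \<noteq> B b)" for a b B
  have "\<exists>B. P a b B" for a b
  proof (cases "a = b")
    case True
    then show ?thesis by (intro exI[of _ "\<lambda>_. 0"]) (simp add: P_def)
  next
    case False
    define d where "d = min 1 (dist a b)"
    have d: "0 < d" "d \<le> 1" "d \<le> dist a b" using False by (auto simp: d_def)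
    \<comment> \<open>The offset \<open>d / 3\<close> makes \<open>w\<close> positive, as collapsing
      requires, and is small enough to survive the factor 2: \<open>B a \<le> d / 3\<close>, whereas
      \<open>B b \<ge> d / 2\<close>.\<close>
    define w where "w x = min 1 (d / 3 + dist x a)" for x
    have w: "continuous_on UNIV w" unfolding w_def by (intro continuous_intros)
    have wpos: "0 < w x" for x using d by (auto simp: w_def add_pos_nonneg)
    obtain B where B: "continuous_on UNIV B" "\<And>x. w x / 2 \<le> B x \<and> B x \<le> w x"
      "\<And>x. x \<in> Q \<Longrightarrow> \<forall>\<^sub>F y in nhds x. B y = B x"
      by (rule collapse_near_countable[OF w _ Q]) (use wpos less_imp_le in auto)
    have "B a \<le> d / 3" using B(2)[of a] by (auto simp: w_def)
    moreover have "d \<le> w b" using d by (auto simp: w_def dist_commute)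
    then have "d / 2 \<le> B b" using B(2)[of b] by auto
    moreover have "0 \<le> B x \<and> B x \<le> 1" for x using B(2)[of x] wpos[of x] by (auto simp: w_def)
    ultimately show ?thesis using B(1,3) d unfolding P_def by (intro exI[of _ B]) auto
  qed
  then obtain \<beta> where \<beta>: "\<And>a b. P a b (\<beta> a b)" by metis
  show ?thesis
  proof (rule that[of "\<lambda>n. case from_nat_into (Q \<times> Q) n of (a, b) \<Rightarrow> \<beta> a b"])
    fix x y assume h: "x \<in> Q" "y \<in> Q" "x \<noteq> y"
    then obtain n where "from_nat_into (Q \<times> Q) n = (x, y)"
      using from_nat_into_surj[of "Q \<times> Q" "(x, y)"] Q by auto
    then show "\<exists>n. (case from_nat_into (Q \<times> Q) n of (a, b) \<Rightarrow> \<beta> a b) x \<noteq>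
        (case from_nat_into (Q \<times> Q) n of (a, b) \<Rightarrow> \<beta> a b) y"
      using \<beta>[of x y] h(3) unfolding P_def by (intro exI[of _ n]) simp
  qed (use \<beta> in \<open>auto simp: P_def split: prod.splits\<close>)
qed

section \<open>Weights of the hairs and injectivity of the two series\<close>

text \<open>
  The infimum is the distance from \<open>s\<^sub>k\<close> to the positions \<open>d > s\<^sub>k\<close> whose hairs reach at least half the
  height \<open>weight (k+1) s * s\<^sub>k\<^sub>+\<^sub>1\<close>; the geometric factor makes the set of such positions finite.
\<close>

fun weight :: "real set \<Rightarrow> nat \<Rightarrow> (nat \<Rightarrow> real) \<Rightarrow> real" where
  "weight D 0 s = 1"
| "weight D (Suc 0) s = (1/2) ^ Suc (to_nat_on D (s 0))"
| "weight D (Suc (Suc k)) s = weight D k s / 4 * (1/2) ^ to_nat_on D (s (Suc k)) *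
     Inf (insert 1 ((\<lambda>d. d - s k) `
       {d \<in> D. s k < d \<and> weight D (Suc k) s * s (Suc k) / 2 \<le> weight D (Suc k) (s(k := d))}))"

declare weight.simps(3) [simp del]

text \<open>All levels of one direction from \<open>k\<close> on. The values 0 and 1 of
  \<open>k\<close> give the coordinates of the plane map; larger \<open>k\<close> give the tails
  left after removing leading terms.\<close>

definition weight_series :: "real set \<Rightarrow> nat \<Rightarrow> (nat \<Rightarrow> real) \<Rightarrow> real" where
  "weight_series D k s = (\<Sum>j. weight D (k + 2 * j) s * s (k + 2 * j))"

lemma Inf_insert_1_bounds:
  fixes A :: "real set"
  assumes "\<And>a. a \<in> A \<Longrightarrow> 0 \<le> a"
  shows "0 \<le> Inf (insert 1 A)" "Inf (insert 1 A) \<le> 1" "a \<in> A \<Longrightarrow> Inf (insert 1 A) \<le> a"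
proof -
  have b: "bdd_below (insert 1 A)" using assms by (intro bdd_belowI[of _ 0]) auto
  show "0 \<le> Inf (insert 1 A)" by (rule cInf_greatest) (use assms in auto)
  show "Inf (insert 1 A) \<le> 1" by (rule cInf_lower[OF _ b]) auto
  show "a \<in> A \<Longrightarrow> Inf (insert 1 A) \<le> a" by (rule cInf_lower[OF _ b]) auto
qed

lemma weight_nonneg: "0 \<le> weight D k s"
proof (induction D k s rule: weight.induct)
  case (3 D k s)
  then show ?case unfolding weight.simps
    by (auto intro!: mult_nonneg_nonneg Inf_insert_1_bounds(1))
qed auto

lemma weight_Suc_Suc_le:
  "weight D (Suc (Suc k)) s \<le> weight D k s / 4 * (1/2) ^ to_nat_on D (s (Suc k))"
proof -
  let ?I = "Inf (insert 1 ((\<lambda>d. d - s k) `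
       {d \<in> D. s k < d \<and> weight D (Suc k) s * s (Suc k) / 2 \<le> weight D (Suc k) (s(k := d))}))"
  have "?I \<le> 1" by (rule Inf_insert_1_bounds(2)) auto
  then have "weight D k s / 4 * (1/2) ^ to_nat_on D (s (Suc k)) * ?I \<le> 
      weight D k s / 4 * (1/2) ^ to_nat_on D (s (Suc k)) * 1"
    by (intro mult_left_mono) (auto simp: weight_nonneg)
  then show ?thesis by (simp only: weight.simps mult_1_right)
qed

lemma weight_step: "weight D (Suc (Suc k)) s \<le> weight D k s / 4"
proof -
  have "weight D k s / 4 * (1/2) ^ to_nat_on D (s (Suc k)) \<le> weight D k s / 4 * 1"
    by (intro mult_left_mono power_le_one) (auto simp: weight_nonneg)
  then show ?thesis using weight_Suc_Suc_le[of D k s] by simp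
qed

lemma weight_le_1: "weight D k s \<le> 1"
proof (induction k rule: induct_nat_012)
  case (ge2 n)
  then show ?case using weight_step[of D n s] weight_nonneg[of D n s] by linarith
qed (auto intro: power_le_one simp flip: power_Suc)

lemma weight_tail: "weight D (k + 2 * j) s \<le> weight D k s * (1/4) ^ j"
proof (induction j)
  case (Suc j)
  then show ?case using weight_step[of D "k + 2 * j" s] by simp
qed simp

text \<open>The index of the last position enters geometrically at every level. For countable
  \<open>D\<close> the index is injective, so only finitely many positions \<open>s k\<close> in
  \<open>D\<close> keep the next weight above a given positive bound.\<close>

lemma weight_Suc_le: "weight D (Suc k) s \<le> (1/2) ^ to_nat_on D (s k)"
proof (cases k)
  case (Suc m)
  have "weight D m s / 4 * (1/2) ^ to_nat_on D (s (Suc m)) \<le> 1 * (1/2) ^ to_nat_on D (s (Suc m))"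
    by (intro mult_right_mono) (use weight_le_1[of D m s] in auto)
  then show ?thesis using weight_Suc_Suc_le[of D m s] unfolding Suc by linarith
qed simp

lemma weight_cong: "(\<And>i. i < k \<Longrightarrow> s i = t i) \<Longrightarrow> weight D k s = weight D k t"
proof (induction k arbitrary: s t rule: induct_nat_012)
  case (ge2 n)
  have "weight D (Suc n) (s(n := d)) = weight D (Suc n) (t(n := d))" for d
    by (rule ge2.IH) (use ge2.prems in auto)
  moreover have "weight D (Suc n) s = weight D (Suc n) t" by (rule ge2.IH) (use ge2.prems in auto)
  moreover have "weight D n s = weight D n t" by (rule ge2.IH) (use ge2.prems in auto)
  ultimately show ?case using ge2.prems[of n] ge2.prems[of "Suc n"] by (simp add: weight.simps(3))
qed auto

text \<open>By induction the threshold \<open>c\<close> is positive, and the geometric factor bounds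
  the indices of the positions reaching it. The infimum is therefore a minimum over finitely many
  positive numbers.\<close>

lemma weight_pos:
  assumes D: "countable D" "D \<subseteq> {0<..}" and s: "\<And>i. s i \<in> D"
  shows "0 < weight D k s"
proof (induction k rule: induct_nat_012)
  case (ge2 n)
  define c where "c = weight D (Suc n) s * s (Suc n) / 2"
  define A where "A = {d \<in> D. s n < d \<and> c \<le> weight D (Suc n) (s(n := d))}"
  have c: "c > 0" using ge2 D s[of "Suc n"] by (auto simp: c_def)
  have "(\<lambda>m. (1/2::real) ^ m) \<longlonglongrightarrow> 0" by (intro LIMSEQ_power_zero) auto
  then have "\<forall>\<^sub>F m in sequentially. (1/2) ^ m < c" by (rule order_tendstoD) (rule c)
  then obtain N where N: "\<And>m. m \<ge> N \<Longrightarrow> (1/2) ^ m < c" by (auto simp: eventually_sequentially)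
  have "to_nat_on D ` A \<subseteq> {..<N}"
  proof clarify
    fix d assume "d \<in> A"
    then have "c \<le> (1/2) ^ to_nat_on D d"
      using weight_Suc_le[of D n "s(n := d)"] by (auto simp: A_def)
    then show "to_nat_on D d < N" using N[of "to_nat_on D d"] by (meson linorder_not_le)
  qed
  moreover have "inj_on (to_nat_on D) A"
    by (rule inj_on_subset[OF inj_on_to_nat_on[OF D(1)]]) (auto simp: A_def)
  ultimately have "finite A" using finite_imageD finite_subset by blast
  then have "Inf (insert 1 ((\<lambda>d. d - s n) ` A)) \<in> insert 1 ((\<lambda>d. d - s n) ` A)"
    by (simp only: cInf_eq_Min finite.insertI finite_imageI insert_not_empty not_False_eq_True Min_in)
  then have "0 < Inf (insert 1 ((\<lambda>d. d - s n) ` A))"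
    by (auto simp: A_def simp del: Inf_insert)
  then show ?case using ge2 by (simp add: weight.simps(3) A_def c_def)
qed auto

text \<open>Here \<open>d\<close> is one of the competitors in the infimum. Since a tail is at most
  \<open>4 / 3\<close> of its first weight, the levels from \<open>k + 2\<close> on in the direction
  of \<open>k\<close> cannot bridge the gap from \<open>s k\<close> to \<open>d\<close>.\<close>

lemma weight_gap:
  assumes "d \<in> D" "s k < d" "weight D (Suc k) s * s (Suc k) / 2 \<le> weight D (Suc k) (s(k := d))"
  shows "weight D (Suc (Suc k)) s \<le> weight D k s * (d - s k) / 4"
proof -
  let ?I = "Inf (insert 1 ((\<lambda>d. d - s k) `
       {d \<in> D. s k < d \<and> weight D (Suc k) s * s (Suc k) / 2 \<le> weight D (Suc k) (s(k := d))}))"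
  have I: "?I \<le> d - s k" "0 \<le> ?I"
    by (rule Inf_insert_1_bounds; use assms in auto)+
  have "weight D k s / 4 * (1/2) ^ to_nat_on D (s (Suc k)) * ?I \<le> weight D k s / 4 * 1 * (d - s k)"
    by (intro mult_mono power_le_one I) (auto simp: weight_nonneg)
  then show ?thesis unfolding weight.simps by simp
qed

text \<open>Weights of equal parity drop at least by a factor 4 per step, so a tail is dominated by
  a geometric series of ratio \<open>1 / 4\<close>.\<close>

lemma
  assumes s: "\<And>i. 0 \<le> s i \<and> s i \<le> 1"
  shows weight_series_unfold: "weight_series D k s = weight D k s * s k + weight_series D (Suc (Suc k)) s"
    and weight_series_nonneg: "0 \<le> weight_series D k s"
    and weight_series_le: "weight_series D k s \<le> 4 / 3 * weight D k s"
proof -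
  have t: "0 \<le> weight D (k + 2 * j) s * s (k + 2 * j)"
    "weight D (k + 2 * j) s * s (k + 2 * j) \<le> weight D k s * (1/4) ^ j" for j k
  proof -
    show "0 \<le> weight D (k + 2 * j) s * s (k + 2 * j)" using s weight_nonneg by simp
    have "weight D (k + 2 * j) s * s (k + 2 * j) \<le> weight D (k + 2 * j) s * 1"
      by (intro mult_left_mono) (use s weight_nonneg in auto)
    then show "weight D (k + 2 * j) s * s (k + 2 * j) \<le> weight D k s * (1/4) ^ j"
      using weight_tail[of D k j s] by simp
  qed
  have g: "summable (\<lambda>j. weight D k s * (1/4::real) ^ j)" for k
    by (intro summable_mult summable_geometric) auto
  have sm: "summable (\<lambda>j. weight D (k + 2 * j) s * s (k + 2 * j))" for k
    by (rule summable_comparison_test'[OF g[of k], of 0]) (use t in \<open>simp add: abs_of_nonneg\<close>)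
  show "weight_series D k s = weight D k s * s k + weight_series D (Suc (Suc k)) s"
    using suminf_split_head[OF sm[of k]] by (simp add: weight_series_def)
  show "0 \<le> weight_series D k s" unfolding weight_series_def by (intro suminf_nonneg sm t)
  have "weight_series D k s \<le> (\<Sum>j. weight D k s * (1/4) ^ j)"
    unfolding weight_series_def by (intro suminf_le t sm g)
  also have "\<dots> = 4 / 3 * weight D k s"
    by (subst suminf_mult) (auto simp: suminf_geometric intro!: summable_geometric)
  finally show "weight_series D k s \<le> 4 / 3 * weight D k s" .
qed

text \<open>Equality in the direction of \<open>k + 1\<close> shows that the hair at
  \<open>t k\<close> is long enough to compete with the height reached from \<open>s k\<close>. The
  gap bound then makes equality in the direction of \<open>k\<close> impossible.\<close>

lemma weight_series_separates_first_difference: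
  assumes D: "countable D" "D \<subseteq> {0<..1}" and s: "\<And>i. s i \<in> D" and t: "\<And>i. t i \<in> D"
    and eq: "\<And>i. i < k \<Longrightarrow> s i = t i" and less: "s k < t k"
    and weight_series: "weight_series D k s = weight_series D k t" "weight_series D (Suc k) s = weight_series D (Suc k) t"
  shows False
proof -
  have s1: "0 \<le> s i \<and> s i \<le> 1" and t1: "0 \<le> t i \<and> t i \<le> 1" for i using s[of i] t[of i] D by auto
  let ?c = "weight D k s"
  have c: "0 < ?c" by (rule weight_pos[OF D(1) _ s]) (use D in auto)
  have ct: "weight D k t = ?c" using eq weight_cong[of k t s] by simp
  have "weight D (Suc k) s * s (Suc k) \<le> weight_series D (Suc k) s"
    using weight_series_unfold[OF s1, of D "Suc k"] weight_series_nonneg[OF s1, of D "Suc (Suc (Suc k))"] by simp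
  also have "\<dots> \<le> 4 / 3 * weight D (Suc k) t" using weight_series weight_series_le[OF t1] by simp
  also have "weight D (Suc k) t = weight D (Suc k) (s(k := t k))"
    by (rule weight_cong) (use eq in \<open>auto simp: less_Suc_eq\<close>)
  \<comment> \<open>The half in the definition of \<open>weight\<close> absorbs the tail constant,
    as \<open>4 / 3 \<le> 2\<close>.\<close>
  finally have "weight D (Suc k) s * s (Suc k) / 2 \<le> weight D (Suc k) (s(k := t k))"
    using weight_nonneg[of D "Suc k" "s(k := t k)"] by linarith
  then have gap: "weight D (Suc (Suc k)) s \<le> ?c * (t k - s k) / 4"
    by (intro weight_gap t less)
  have "?c * t k \<le> weight_series D k t"
    using weight_series_unfold[OF t1, of D k] weight_series_nonneg[OF t1, of D "Suc (Suc k)"] ct by simp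
  also have "\<dots> = ?c * s k + weight_series D (Suc (Suc k)) s" using weight_series weight_series_unfold[OF s1, of D k] by simp
  also have "\<dots> \<le> ?c * s k + 4 / 3 * weight D (Suc (Suc k)) s" using weight_series_le[OF s1] by simp
  \<comment> \<open>The remaining levels of \<open>s\<close> cover at most
    \<open>4 / 3 * 1 / 4 = 1 / 3\<close> of the required distance.\<close>
  finally have "?c * (t k - s k) \<le> 4 / 3 * (?c * (t k - s k) / 4)"
    using gap by (simp add: algebra_simps)
  moreover have "0 < ?c * (t k - s k)" using c less by simp
  ultimately show False by linarith
qed

text \<open>Positions are decoded one by one: equal tails at \<open>k\<close> and
  \<open>k + 1\<close> force \<open>s k = t k\<close>, the leading terms at \<open>k\<close> cancel,
  and the tails at \<open>k + 1\<close> and \<open>k + 2\<close> are equal again.\<close>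

lemma weight_series_inj:
  assumes D: "countable D" "D \<subseteq> {0<..1}" and s: "\<And>i. s i \<in> D" and t: "\<And>i. t i \<in> D"
    and weight_series: "weight_series D 0 s = weight_series D 0 t" "weight_series D 1 s = weight_series D 1 t"
  shows "s = t"
proof -
  have s1: "0 \<le> s i \<and> s i \<le> 1" and t1: "0 \<le> t i \<and> t i \<le> 1" for i using s[of i] t[of i] D by auto
  have "(\<forall>i<k. s i = t i) \<and> weight_series D k s = weight_series D k t \<and> weight_series D (Suc k) s = weight_series D (Suc k) t" for k
  proof (induction k)
    case (Suc k)
    then have eq: "\<And>i. i < k \<Longrightarrow> s i = t i" and tr: "weight_series D k s = weight_series D k t"
      "weight_series D (Suc k) s = weight_series D (Suc k) t" by auto
    have k: "s k = t k"
      using weight_series_separates_first_difference[of D s t k, OF D s t eq _ tr]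
        weight_series_separates_first_difference[of D t s k, OF D t s eq[symmetric] _ tr[symmetric]]
      by (meson linorder_neqE_linordered_idom)
    moreover have "weight D k s = weight D k t" by (rule weight_cong) (rule eq)
    ultimately have "weight_series D (Suc (Suc k)) s = weight_series D (Suc (Suc k)) t"
      using tr weight_series_unfold[OF s1, of D k] weight_series_unfold[OF t1, of D k] by simp
    then show ?case using eq tr k by (auto simp: less_Suc_eq)
  qed (use weight_series in auto)
  then show ?thesis by (intro ext) (metis lessI)
qed

section \<open>Continuity of the series\<close>

text \<open>The weight may depend on the earlier values discontinuously. Where \<open>u j\<close>
  vanishes, boundedness of the weight gives continuity of the term; elsewhere all earlier
  \<open>u i\<close> are locally constant, hence so is the weight. The sum converges
  uniformly.\<close>

lemma continuous_on_track:
  fixes u :: "nat \<Rightarrow> 'a::topological_space \<Rightarrow> real"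
  assumes cont: "\<And>k. continuous_on UNIV (u k)" and u: "\<And>k x. 0 \<le> u k x \<and> u k x \<le> 1"
    and const: "\<And>i k x. u k x \<noteq> 0 \<Longrightarrow> i < k \<Longrightarrow> \<forall>\<^sub>F y in nhds x. u i y = u i x"
  shows "continuous_on UNIV (\<lambda>x. weight_series D k (\<lambda>i. u i x))"
proof -
  let ?f = "\<lambda>j x. weight D j (\<lambda>i. u i x) * u j x"
  have f: "continuous_on UNIV (?f j)" for j
    unfolding continuous_on_def
  proof
    fix x :: 'a
    have uj: "(u j \<longlongrightarrow> u j x) (at x)" using cont[of j] unfolding continuous_on_def by blast
    show "(?f j \<longlongrightarrow> ?f j x) (at x within UNIV)"
    proof (cases "u j x = 0")
      case True
      have "norm (?f j y) \<le> u j y" for y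
        using mult_left_le_one_le[OF _ weight_nonneg weight_le_1] mult_nonneg_nonneg[OF weight_nonneg] u
        by (simp only: real_norm_def abs_of_nonneg)
      then have "\<forall>\<^sub>F y in at x. norm (?f j y) \<le> u j y" by (intro always_eventually allI)
      moreover have "(u j \<longlongrightarrow> 0) (at x)" using uj unfolding True .
      ultimately have "(?f j \<longlongrightarrow> 0) (at x)" by (rule Lim_null_comparison)
      then show ?thesis using True by simp
    next
      case False
      have "\<forall>\<^sub>F y in nhds x. \<forall>i\<in>{..<j}. u i y = u i x"
        by (intro eventually_ball_finite) (use const[OF False] in auto)
      then have "\<forall>\<^sub>F y in nhds x. weight D j (\<lambda>i. u i y) = weight D j (\<lambda>i. u i x)"
        by eventually_elim (rule weight_cong, auto)
      then have "\<forall>\<^sub>F y in at x. weight D j (\<lambda>i. u i x) * u j y = ?f j y"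
        unfolding eventually_at_filter by eventually_elim simp
      moreover have "((\<lambda>y. weight D j (\<lambda>i. u i x) * u j y) \<longlongrightarrow> ?f j x) (at x)"
        by (intro tendsto_intros uj)
      ultimately show ?thesis by (rule Lim_transform_eventually[rotated])
    qed
  qed
  have "uniform_limit UNIV (\<lambda>n x. \<Sum>j<n. ?f (k + 2 * j) x)
     (\<lambda>x. \<Sum>j. ?f (k + 2 * j) x) sequentially"
  proof (rule Weierstrass_m_test)
    show "norm (?f (k + 2 * j) x) \<le> (1/4) ^ j" for j x
    proof -
      let ?c = "\<lambda>j. weight D j (\<lambda>i. u i x)"
      have "?f (k + 2 * j) x \<le> ?c (k + 2 * j)" by (rule mult_left_le) (use u weight_nonneg in auto)
      also have "\<dots> \<le> ?c k * (1/4) ^ j" by (rule weight_tail)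
      also have "\<dots> \<le> 1 * (1/4) ^ j" by (intro mult_right_mono weight_le_1) simp
      finally have "?f (k + 2 * j) x \<le> (1/4) ^ j" by simp
      moreover have "0 \<le> ?f (k + 2 * j) x" by (intro mult_nonneg_nonneg weight_nonneg) (use u in auto)
      ultimately show ?thesis unfolding real_norm_def by linarith
    qed
    show "summable (\<lambda>j. (1/4::real) ^ j)" by (intro summable_geometric) auto
  qed
  then show ?thesis unfolding weight_series_def
    by (rule uniform_limit_theorem[rotated]) (auto intro!: always_eventually continuous_on_sum f)
qed

section \<open>Inductive construction of the functions on the power\<close>

text \<open>
  \<open>\<rho>\<close> replaces all coordinates beyond k by the fixed point c; it maps \<open>Q\<^sup>\<omega>\<close> onto a countable subset of itself.
\<close>

lemma encoding_step:
  fixes Q :: "'a::metric_space set" and c :: 'a and k :: nat and v :: "(nat \<Rightarrow> 'a) \<Rightarrow> real"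
  defines "Z \<equiv> {x :: nat \<Rightarrow> 'a. \<forall>n. x n \<in> Q}"
    and "\<rho> \<equiv> \<lambda>x i. if i < Suc k then x i else c"
  assumes Q: "countable Q" "c \<in> Q"
    and W: "open W" "Z \<subseteq> W" "\<forall>x y. (\<forall>i<k. x i = y i) \<longrightarrow> x \<in> W \<longrightarrow> y \<in> W"
    and v: "continuous_on UNIV v" "\<And>x. 0 \<le> v x \<and> v x \<le> 1" "\<And>x. v (\<rho> x) = v x"
      "\<forall>x\<in>Z. \<forall>\<^sub>F y in nhds x. v y = v x"
  shows "\<exists>(u :: (nat \<Rightarrow> 'a) \<Rightarrow> real) W'. continuous_on UNIV u \<and> (\<forall>x. 0 \<le> u x \<and> u x \<le> 1) \<and>
      (\<forall>x. x \<notin> W \<longrightarrow> u x = 0) \<and> countable (u ` Z) \<and> (\<forall>x\<in>Z. 0 < u x) \<and>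
      (\<forall>x\<in>Z. \<forall>y\<in>Z. u x = u y \<longrightarrow> v x = v y) \<and>
      open W' \<and> Z \<subseteq> W' \<and> W' \<subseteq> W \<and>
      (\<forall>x y. (\<forall>i<Suc k. x i = y i) \<longrightarrow> x \<in> W' \<longrightarrow> y \<in> W') \<and>
      (\<forall>x\<in>W'. \<forall>\<^sub>F y in nhds x. u y = u x)"
proof -
  have \<rho>: "continuous_on UNIV \<rho>" unfolding \<rho>_def
  proof (rule continuous_on_coordinatewise_then_product)
    show "continuous_on UNIV (\<lambda>x. if i < Suc k then x i else c)" for i by (cases "i < Suc k") auto
  qed
  have \<rho>Z: "\<rho> x \<in> Z" if "x \<in> Z" for x using that Q by (auto simp: Z_def \<rho>_def)
  \<comment> \<open>\<open>Z\<close> may be uncountable, but \<open>\<rho>\<close> only sees finite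
    tuples from \<open>Q\<close>; this gives the countable set on which \<open>encoding_bump\<close>
    is applied.\<close>
  have sub: "\<rho> ` Z \<subseteq> \<rho> ` (Pi\<^sub>E {..<Suc k} (\<lambda>_. Q))"
  proof clarify
    fix x assume "x \<in> Z"
    then have "restrict x {..<Suc k} \<in> Pi\<^sub>E {..<Suc k} (\<lambda>_. Q)" by (simp add: Z_def)
    moreover have "\<rho> x = \<rho> (restrict x {..<Suc k})" by (auto simp: \<rho>_def)
    ultimately show "\<rho> x \<in> \<rho> ` (Pi\<^sub>E {..<Suc k} (\<lambda>_. Q))" by blast
  qed
  have "countable (Pi\<^sub>E {..<Suc k} (\<lambda>_. Q))" using Q by (intro countable_PiE) auto
  then have C: "countable (\<rho> ` Z)" by (rule countable_subset[OF sub countable_image])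
  have CW: "\<rho> ` Z \<subseteq> W" using \<rho>Z W(2) by blast
  have vC: "\<forall>x\<in>\<rho> ` Z. \<forall>\<^sub>F y in nhds x. v y = v x" using \<rho>Z v(4) by blast
  obtain b :: "(nat \<Rightarrow> 'a) \<Rightarrow> real" where b: "continuous_on UNIV b" "\<forall>x. 0 \<le> b x \<and> b x \<le> 1" "\<forall>x. x \<notin> W \<longrightarrow> b x = 0"
    "\<forall>x\<in>\<rho> ` Z. 0 < b x" "\<forall>x\<in>\<rho> ` Z. \<forall>\<^sub>F y in nhds x. b y = b x"
    "\<forall>x\<in>\<rho> ` Z. \<forall>y\<in>\<rho> ` Z. b x = b y \<longrightarrow> v x = v y"
    using encoding_bump[OF W(1) CW C v(1,2) vC] by (elim exE conjE) (rule that, assumption+)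
  \<comment> \<open>The next permitted support: the part of \<open>W\<close> where \<open>b\<close>
    is locally constant at \<open>\<rho> x\<close>. A later function supported here vanishes
    wherever the present one is not locally constant.\<close>
  let ?W = "\<rho> -` (W \<inter> {x. \<forall>\<^sub>F y in nhds x. b y = b x})"
  \<comment> \<open>Membership in \<open>W\<close> is decided by the coordinates below
    \<open>k\<close>, which \<open>\<rho>\<close> keeps.\<close>
  have \<rho>W: "\<rho> x \<in> W \<longleftrightarrow> x \<in> W" for x
    using W(3)[rule_format, of "\<rho> x" x] W(3)[rule_format, of x "\<rho> x"] by (auto simp: \<rho>_def)
  show ?thesis
  proof (intro exI[of _ "\<lambda>x. b (\<rho> x)"] exI[of _ ?W] conjI)
    show "continuous_on UNIV (\<lambda>x. b (\<rho> x))"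
      by (rule continuous_on_compose2[OF b(1) \<rho>]) auto
    show "\<forall>x. 0 \<le> b (\<rho> x) \<and> b (\<rho> x) \<le> 1" using b(2) by blast
    show "\<forall>x. x \<notin> W \<longrightarrow> b (\<rho> x) = 0" using b(3) \<rho>W by blast
    show "countable ((\<lambda>x. b (\<rho> x)) ` Z)" using countable_image[OF C, of b] by (simp add: image_image)
    show "\<forall>x\<in>Z. 0 < b (\<rho> x)" using b(4) by blast
    show "\<forall>x\<in>Z. \<forall>y\<in>Z. b (\<rho> x) = b (\<rho> y) \<longrightarrow> v x = v y"
      using b(6)[rule_format, OF imageI imageI] v(3) by metis
    show "open ?W" by (intro open_vimage open_Int W(1) open_locally_constant \<rho>)
    show "Z \<subseteq> ?W" using b(5) \<rho>Z W(2) by blast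
    show "?W \<subseteq> W" using \<rho>W by blast
    show "\<forall>x y. (\<forall>i<Suc k. x i = y i) \<longrightarrow> x \<in> ?W \<longrightarrow> y \<in> ?W"
    proof (intro allI impI)
      fix x y :: "nat \<Rightarrow> 'a" assume h: "\<forall>i<Suc k. x i = y i" "x \<in> ?W"
      have "\<rho> x = \<rho> y" using h(1) by (auto simp: \<rho>_def)
      then show "y \<in> ?W" using h(2) by simp
    qed
    show "\<forall>x\<in>?W. \<forall>\<^sub>F y in nhds x. b (\<rho> y) = b (\<rho> x)"
      by (intro ballI locally_constant_compose[OF \<rho>]) auto
  qed
qed

text \<open>Dependent choice of functions together with shrinking supports. The \<open>k\<close>-th
  function records one coordinate seen through one separating function, so together they determine a
  point of \<open>Z\<close>.\<close>

lemma encoding_sequence: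
  fixes Q :: "'a::metric_space set"
  defines "Z \<equiv> {x :: nat \<Rightarrow> 'a. \<forall>n. x n \<in> Q}"
  assumes Q: "countable Q" "Q \<noteq> {}"
  obtains u :: "nat \<Rightarrow> (nat \<Rightarrow> 'a) \<Rightarrow> real" where
    "\<And>k. continuous_on UNIV (u k)" "\<And>k x. 0 \<le> u k x \<and> u k x \<le> 1"
    "\<And>k. countable (u k ` Z)" "\<And>k x. x \<in> Z \<Longrightarrow> 0 < u k x"
    "\<And>i k x. u k x \<noteq> 0 \<Longrightarrow> i < k \<Longrightarrow> \<forall>\<^sub>F y in nhds x. u i y = u i x"
    "\<And>x y. x \<in> Z \<Longrightarrow> y \<in> Z \<Longrightarrow> (\<And>k. u k x = u k y) \<Longrightarrow> x = y"
proof -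
  obtain \<phi> :: "nat \<Rightarrow> 'a \<Rightarrow> real" where \<phi>: "\<And>n. continuous_on UNIV (\<phi> n)" "\<And>n x. 0 \<le> \<phi> n x \<and> \<phi> n x \<le> 1"
    "\<And>n x. x \<in> Q \<Longrightarrow> \<forall>\<^sub>F y in nhds x. \<phi> n y = \<phi> n x"
    "\<And>x y. x \<in> Q \<Longrightarrow> y \<in> Q \<Longrightarrow> x \<noteq> y \<Longrightarrow> \<exists>n. \<phi> n x \<noteq> \<phi> n y"
    using separating_locally_constant[OF Q(1)] by blast
  obtain c where c: "c \<in> Q" using Q by blast
  \<comment> \<open>Pairing makes every test function meet every coordinate. The coordinate decoded
    from \<open>k\<close> is at most \<open>k\<close>, so it survives the truncation after
    \<open>Suc k\<close> coordinates.\<close>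
  define v where "v k x = \<phi> (fst (prod_decode k)) (x (snd (prod_decode k)))" for k and x :: "nat \<Rightarrow> 'a"
  have v1: "continuous_on UNIV (v k)" for k unfolding v_def
    by (rule continuous_on_compose2[OF \<phi>(1)]) auto
  have v2: "0 \<le> v k x \<and> v k x \<le> 1" for k x unfolding v_def by (rule \<phi>(2))
  have v3: "v k (\<lambda>i. if i < Suc k then x i else c) = v k x" for k x
  proof -
    have "snd (prod_decode k) \<le> k"
      using le_prod_encode_2[of "snd (prod_decode k)" "fst (prod_decode k)"] by simp
    then show ?thesis by (simp add: v_def)
  qed
  have v4: "\<forall>x\<in>Z. \<forall>\<^sub>F y in nhds x. v k y = v k x" for k
  proof
    fix x assume "x \<in> Z"
    then have "x (snd (prod_decode k)) \<in> Q" by (simp add: Z_def)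
    then show "\<forall>\<^sub>F y in nhds x. v k y = v k x" unfolding v_def
      by (rule locally_constant_compose[OF continuous_on_product_coordinates \<phi>(3)])
  qed
  define inv where "inv k W \<longleftrightarrow> open W \<and> Z \<subseteq> W \<and> (\<forall>x y. (\<forall>i<k. x i = y i) \<longrightarrow> x \<in> W \<longrightarrow> y \<in> W)"
    for k :: nat and W
  define step where "step k W u W' \<longleftrightarrow> continuous_on UNIV u \<and> (\<forall>x. 0 \<le> u x \<and> u x \<le> 1) \<and>
      (\<forall>x. x \<notin> W \<longrightarrow> u x = 0) \<and> countable (u ` Z) \<and> (\<forall>x\<in>Z. 0 < u x) \<and>
      (\<forall>x\<in>Z. \<forall>y\<in>Z. u x = u y \<longrightarrow> v k x = v k y) \<and>
      open W' \<and> Z \<subseteq> W' \<and> W' \<subseteq> W \<and>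
      (\<forall>x y. (\<forall>i<Suc k. x i = y i) \<longrightarrow> x \<in> W' \<longrightarrow> y \<in> W') \<and>
      (\<forall>x\<in>W'. \<forall>\<^sub>F y in nhds x. u y = u x)"
    for k W W' and u :: "(nat \<Rightarrow> 'a) \<Rightarrow> real"
  have ex: "\<exists>u W'. inv (Suc k) W' \<and> step k W u W'" if "inv k W" for k W
  proof -
    have W: "open W" "Z \<subseteq> W" "\<forall>x y. (\<forall>i<k. x i = y i) \<longrightarrow> x \<in> W \<longrightarrow> y \<in> W"
      using that unfolding inv_def by blast+
    have "\<exists>u W'. step k W u W'" unfolding step_def
      by (rule encoding_step[OF Q(1) c, of W k "v k", folded Z_def, OF W v1 v2 v3 v4])
    then obtain u W' where st: "step k W u W'" by blast
    have "inv (Suc k) W'"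
      using st unfolding step_def inv_def by (elim conjE) (intro conjI; assumption)
    then show ?thesis using st by blast
  qed
  have "\<exists>f. \<forall>n. inv n (snd (f n)) \<and> step n (snd (f n)) (fst (f (Suc n))) (snd (f (Suc n)))"
  proof (rule dependent_nat_choice)
    show "\<exists>s :: ((nat \<Rightarrow> 'a) \<Rightarrow> real) \<times> (nat \<Rightarrow> 'a) set. inv 0 (snd s)"
      by (rule exI[of _ "(\<lambda>_. 0, UNIV)"]) (simp add: inv_def)
    show "\<exists>t. inv (Suc n) (snd t) \<and> step n (snd s) (fst t) (snd t)" if "inv n (snd s)"
      for s :: "((nat \<Rightarrow> 'a) \<Rightarrow> real) \<times> (nat \<Rightarrow> 'a) set" and n
      using ex[OF that] by auto
  qed
  then obtain f where f: "\<And>n. step n (snd (f n)) (fst (f (Suc n))) (snd (f (Suc n)))" by blast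
  \<comment> \<open>The function chosen in passing from \<open>W n\<close> to
    \<open>W (Suc n)\<close> is stored at \<open>Suc n\<close>; the dummy function at index 0 is
    skipped.\<close>
  define u W where "u n = fst (f (Suc n))" and "W n = snd (f n)" for n
  have st: "step n (W n) (u n) (W (Suc n))" for n using f unfolding u_def W_def .
  have sub: "W m \<subseteq> W n" if "n \<le> m" for m n
    by (rule lift_Suc_antimono_le[of W, OF _ that]) (use st step_def in blast)
  show ?thesis
  proof (rule that[of u])
    show "continuous_on UNIV (u k)" "\<And>x. 0 \<le> u k x \<and> u k x \<le> 1" "countable (u k ` Z)"
      "\<And>x. x \<in> Z \<Longrightarrow> 0 < u k x" for k
      using st[of k] unfolding step_def by blast+
    show "\<forall>\<^sub>F y in nhds x. u i y = u i x" if "u k x \<noteq> 0" "i < k" for i k x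
    proof -
      \<comment> \<open>\<open>u k\<close> vanishes off \<open>W k\<close>, and \<open>W k\<close>
        is contained in \<open>W (Suc i)\<close>, where \<open>u i\<close> is locally
        constant.\<close>
      have "x \<in> W k" using that(1) st[of k] unfolding step_def by blast
      then have "x \<in> W (Suc i)" using sub[of "Suc i" k] that(2) by auto
      then show ?thesis using st[of i] unfolding step_def by blast
    qed
    fix x y assume xy: "x \<in> Z" "y \<in> Z" and eq: "\<And>k. u k x = u k y"
    have "v k x = v k y" for k using st[of k] xy eq unfolding step_def by blast
    then have "\<phi> n (x j) = \<phi> n (y j)" for n j
      using v_def[of "prod_encode (n, j)"] by (metis fst_conv snd_conv prod_encode_inverse)
    then have "x j = y j" for j using \<phi>(4)[of "x j" "y j"] xy unfolding Z_def by blast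
    then show "x = y" by blast
  qed
qed

section \<open>The plane map for metric spaces\<close>

lemma countable_omega_power_plane_map:
  fixes Q :: "'a::metric_space set"
  assumes Q: "countable Q"
  shows "\<exists>f :: (nat \<Rightarrow> 'a) \<Rightarrow> real ^ 2. continuous_on UNIV f \<and> inj_on f {x. \<forall>n. x n \<in> Q}"
proof (cases "Q = {}")
  case True
  then show ?thesis by (intro exI[of _ "\<lambda>_. 0"]) simp
next
  case False
  define Z where "Z = {x :: nat \<Rightarrow> 'a. \<forall>n. x n \<in> Q}"
  obtain u :: "nat \<Rightarrow> (nat \<Rightarrow> 'a) \<Rightarrow> real" where u:
    "\<And>k. continuous_on UNIV (u k)" "\<And>k x. 0 \<le> u k x \<and> u k x \<le> 1"
    "\<And>k. countable (u k ` Z)" "\<And>k x. x \<in> Z \<Longrightarrow> 0 < u k x"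
    "\<And>i k x. u k x \<noteq> 0 \<Longrightarrow> i < k \<Longrightarrow> \<forall>\<^sub>F y in nhds x. u i y = u i x"
    "\<And>x y. x \<in> Z \<Longrightarrow> y \<in> Z \<Longrightarrow> (\<And>k. u k x = u k y) \<Longrightarrow> x = y"
    using encoding_sequence[OF Q False] unfolding Z_def by blast
  \<comment> \<open>A single countable set of positions for all levels, so that every sequence of
    values \<open>u i x\<close> with \<open>x\<close> in \<open>Z\<close> stays in
    \<open>D\<close>.\<close>
  define D where "D = (\<Union>k. u k ` Z)"
  have D: "countable D" "D \<subseteq> {0<..1}" using u(2-4) by (auto simp: D_def)
  define t where "t k x = weight_series D k (\<lambda>i. u i x)" for k x
  have t: "continuous_on UNIV (t k)" for k
    unfolding t_def by (rule continuous_on_track[OF u(1,2,5)])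
  let ?f = "\<lambda>x. \<chi> i::2. if i = 1 then t 0 x else t 1 x"
  have "continuous_on UNIV (\<lambda>x. if i = 1 then t 0 x else t 1 x)" for i :: 2
    using t by (cases "i = 1") auto
  then have "continuous_on UNIV ?f" by (rule continuous_on_vec_lambda)
  moreover have "inj_on ?f Z"
  proof (rule inj_onI)
    fix x y assume xy: "x \<in> Z" "y \<in> Z" and eq: "?f x = ?f y"
    have "?f x $ 1 = ?f y $ 1" "?f x $ 2 = ?f y $ 2" using eq by simp_all
    then have "t 0 x = t 0 y" "t 1 x = t 1 y" by simp_all
    then have "(\<lambda>i. u i x) = (\<lambda>i. u i y)"
      unfolding t_def by (intro weight_series_inj[OF D]) (use xy in \<open>auto simp: D_def\<close>)
    then show "x = y" using u(6)[OF xy] by (metis (no_types))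
  qed
  ultimately show ?thesis unfolding Z_def by blast
qed

section \<open>Reduction of Tychonoff spaces to the metric case\<close>

text \<open>Points are closed, so complete regularity separates each pair from \<open>Q\<close> by a
  real function. Enumerating the countably many pairs gives one map into the metrizable space of
  real sequences.\<close>

lemma countable_separating_map:
  assumes X: "tychonoff_space X" and Q: "Q \<subseteq> topspace X" "countable Q"
  obtains H :: "'a \<Rightarrow> nat \<Rightarrow> real" where "continuous_map X euclidean H" "inj_on H Q"
proof -
  have "\<exists>h :: 'a \<Rightarrow> real. continuous_map X euclidean h \<and> (a \<noteq> b \<longrightarrow> h a \<noteq> h b)"
    if "a \<in> Q" "b \<in> Q" for a b
  proof (cases "a = b")
    case True
    then show ?thesis by (intro exI[of _ "\<lambda>_. 0"]) simp
  next
    case False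
    have "closedin X {b}" using X Q that by (auto simp: tychonoff_space_def t1_space_closedin_singleton)
    moreover have "a \<in> topspace X - {b}" using Q that False by auto
    ultimately obtain h :: "'a \<Rightarrow> real" where "continuous_map X (top_of_set {0..1}) h"
      "h a = 0" "h ` {b} \<subseteq> {1}"
      using X unfolding tychonoff_space_def completely_regular_space_def by blast
    then show ?thesis by (intro exI[of _ h]) (auto simp: continuous_map_in_subtopology)
  qed
  then have "\<forall>p \<in> Q \<times> Q. \<exists>h :: 'a \<Rightarrow> real. continuous_map X euclidean h \<and>
      (fst p \<noteq> snd p \<longrightarrow> h (fst p) \<noteq> h (snd p))"
    by auto
  from bchoice[OF this] obtain h where
      "\<forall>p \<in> Q \<times> Q. continuous_map X euclidean (h p :: 'a \<Rightarrow> real) \<and>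
        (fst p \<noteq> snd p \<longrightarrow> h p (fst p) \<noteq> h p (snd p))" ..
  then obtain h :: "'a \<times> 'a \<Rightarrow> 'a \<Rightarrow> real" where
    h: "\<And>p. p \<in> Q \<times> Q \<Longrightarrow> continuous_map X euclidean (h p)"
    "\<And>p. p \<in> Q \<times> Q \<Longrightarrow> fst p \<noteq> snd p \<Longrightarrow> h p (fst p) \<noteq> h p (snd p)"
    by metis
  show ?thesis
  proof (cases "Q = {}")
    case True
    then show ?thesis by (intro that[of "\<lambda>_ _. 0"]) auto
  next
    case False
    let ?e = "from_nat_into (Q \<times> Q)"
    show ?thesis
    proof (rule that[of "\<lambda>x n. h (?e n) x"])
      have "continuous_map X euclidean (h (?e n))" for n
        by (rule h(1), rule from_nat_into) (use False in simp)
      then show "continuous_map X euclidean (\<lambda>x n. h (?e n) x)"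
        by (simp add: continuous_map_componentwise_UNIV flip: euclidean_product_topology)
      show "inj_on (\<lambda>x n. h (?e n) x) Q"
      proof (rule inj_onI, rule ccontr)
        fix x y assume xy: "x \<in> Q" "y \<in> Q" "x \<noteq> y" and eq: "(\<lambda>n. h (?e n) x) = (\<lambda>n. h (?e n) y)"
        obtain n where "?e n = (x, y)"
          using from_nat_into_surj[of "Q \<times> Q" "(x, y)"] Q xy by auto
        with fun_cong[OF eq, of n] h(2)[of "(x, y)"] xy show False by simp
      qed
    qed
  qed
qed

theorem theorem3p8:
  fixes X :: "'a topology" and Q :: "'a set"
  assumes "tychonoff_space X" and "Q \<subseteq> topspace X" and "countable Q"
  shows "\<exists>f :: (nat \<Rightarrow> 'a) \<Rightarrow> real ^ 2.
    continuous_map (omega_power X) euclidean f \<and>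
    inj_on f {x. \<forall>n. x n \<in> Q}"
proof -
  obtain H :: "'a \<Rightarrow> nat \<Rightarrow> real" where H: "continuous_map X euclidean H" "inj_on H Q"
    using countable_separating_map[OF assms] by blast
  obtain f :: "(nat \<Rightarrow> nat \<Rightarrow> real) \<Rightarrow> real ^ 2" where
    f: "continuous_on UNIV f" "inj_on f {x. \<forall>n. x n \<in> H ` Q}"
    using countable_omega_power_plane_map[of "H ` Q"] assms(3) by auto
  \<comment> \<open>Acting coordinatewise, \<open>H\<close> carries sequences in \<open>Q\<close>
    injectively to sequences in its image, where the metric case applies.\<close>
  let ?H = "\<lambda>(x :: nat \<Rightarrow> 'a) n. H (x n)"
  have "continuous_map (omega_power X) euclidean (\<lambda>x. H (x n))" for n
    using continuous_map_compose[OF continuous_map_product_projection[of n UNIV "\<lambda>_. X"] H(1)]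
    by (simp add: omega_power_def comp_def)
  then have "continuous_map (omega_power X) (product_topology (\<lambda>_. euclidean) UNIV) ?H"
    unfolding continuous_map_componentwise_UNIV by blast
  then have "continuous_map (omega_power X) euclidean ?H"
    unfolding euclidean_product_topology .
  then have "continuous_map (omega_power X) euclidean (f \<circ> ?H)"
    by (rule continuous_map_compose) (use f(1) in simp)
  moreover have "inj_on (f \<circ> ?H) {x. \<forall>n. x n \<in> Q}"
  proof (rule comp_inj_on)
    show "inj_on ?H {x. \<forall>n. x n \<in> Q}"
    proof (rule inj_onI)
      fix x y :: "nat \<Rightarrow> 'a"
      assume xy: "x \<in> {x. \<forall>n. x n \<in> Q}" "y \<in> {x. \<forall>n. x n \<in> Q}" and eq: "?H x = ?H y"
      have "x n = y n" for n by (rule inj_onD[OF H(2) fun_cong[OF eq]]) (use xy in auto)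
      then show "x = y" by (rule ext)
    qed
    show "inj_on f (?H ` {x. \<forall>n. x n \<in> Q})" by (rule inj_on_subset[OF f(2)]) auto
  qed
  ultimately show ?thesis by blast
qed

end
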